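(* Let $m$ be an odd positive integer. Then $m$ is the smallest period of the sequence $\{t_n \bmod m\}_{n\ge0}$, i.e. $t_{n+m}\equiv t_n\pmod m$ for all $n\ge0$, and no positive integer $d<m$ satisfies $t_{n+d}\equiv t_n\pmod m$ for all $n\ge0$.
   Context: $t_n$ is the number of involutions of $[n]$ (permutations $\pi$ with $\pi^2=1$), with $t_0=1$. *)

theory Defs
  imports "HOL-Combinatorics.Permutations" "HOL-Number_Theory.Cong"
begin

(* The identity counts as an involution, since the condition is only p o p = id. *)
definition num_involutions :: "nat \<Rightarrow> nat" where
  "num_involutions n = card {p. p permutes {1..n} \<and> p \<circ> p = id}"

lemma num_involutions_0: "num_involutions 0 = 1"
proof -
  have "{p::nat \<Rightarrow> nat. p permutes {1..0} \<and> p \<circ> p = id} = {id}"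
    by auto
  then show ?thesis
    by (simp add: num_involutions_def)
qed

end

theory Submission
  imports Defs
begin

text \<open>
  Splitting by the image of a point gives \<open>t (n+2) = t (n+1) + (n+1) * t n\<close>, and counting by the
  number \<open>k\<close> of 2-cycles gives \<open>t n = (\<Sum>k. (n choose 2k) * (2k-1)!!)\<close>. For \<open>n = m\<close> odd and \<open>k > 0\<close>
  the \<open>k\<close>-th summand multiplied by the unit \<open>2 ^ k\<close> is \<open>m * (m-1 choose 2k-1) * ((2k-1)! / k!)\<close>,
  so \<open>t m = 1\<close> modulo \<open>m\<close>. The recurrence then gives \<open>t (m+1) = 1\<close> and propagates the
  period \<open>m\<close>. Conversely, if \<open>d\<close> is a period then reading the recurrence at \<open>d\<close> modulo \<open>m\<close>
  gives \<open>2 = 1 + (d + 1)\<close>, so \<open>m\<close> divides \<open>d\<close>.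
\<close>

text \<open>Arbitrary ground sets allow points to be deleted without relabelling the rest as an
  initial segment.\<close>

definition involutions_on :: "'a set \<Rightarrow> ('a \<Rightarrow> 'a) set" where
  "involutions_on S = {p. p permutes S \<and> p \<circ> p = id}"

lemma finite_involutions_on: "finite S \<Longrightarrow> finite (involutions_on S)"
  unfolding involutions_on_def by (rule finite_subset[OF _ finite_permutations[of S]]) auto

lemma involutions_on_fixing:
  assumes "a \<in> S"
  shows "{p \<in> involutions_on S. p a = a} = involutions_on (S - {a})"
  using assms unfolding involutions_on_def permutes_def by auto

text \<open>Composition with \<open>transpose a b\<close> undoes itself, and it exchanges
  involutions fixing both \<open>a\<close> and \<open>b\<close> with those having the 2-cycle (a
  b).\<close>

lemma involutions_on_swapping:
  assumes "a \<in> S" "b \<in> S" "a \<noteq> b"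
  shows "bij_betw (\<lambda>p. transpose a b \<circ> p) (involutions_on (S - {a, b}))
    {p \<in> involutions_on S. p a = b}"
proof (rule bij_betw_byWitness[where f' = "\<lambda>p. transpose a b \<circ> p"])
  show "\<forall>p\<in>involutions_on (S - {a, b}). transpose a b \<circ> (transpose a b \<circ> p) = p"
    by (simp add: fun_eq_iff)
  show "\<forall>p\<in>{p \<in> involutions_on S. p a = b}. transpose a b \<circ> (transpose a b \<circ> p) = p"
    by (simp add: fun_eq_iff)
  show "(\<lambda>p. transpose a b \<circ> p) ` involutions_on (S - {a, b}) \<subseteq> {p \<in> involutions_on S. p a = b}"
  proof (rule image_subsetI)
    fix p assume "p \<in> involutions_on (S - {a, b})"
    then have perm: "p permutes S - {a, b}" and pp: "\<And>x. p (p x) = x"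
      by (auto simp: involutions_on_def fun_eq_iff)
    have fixed: "p a = a" "p b = b"
      using perm by (auto simp: permutes_def)
    \<comment> \<open>As \<open>p\<close> is injective, no third point maps to \<open>a\<close> or
      \<open>b\<close>; hence the transposition leaves \<open>p x\<close> alone.\<close>
    have other: "p x \<noteq> a \<and> p x \<noteq> b" if "x \<noteq> a" "x \<noteq> b" for x
      using that fixed pp by metis
    have "(transpose a b \<circ> p) permutes S"
      using perm assms by (intro permutes_compose permutes_swap_id) (auto intro: permutes_subset)
    moreover have "(transpose a b \<circ> p) \<circ> (transpose a b \<circ> p) = id"
    proof
      fix x
      show "((transpose a b \<circ> p) \<circ> (transpose a b \<circ> p)) x = id x"
        using fixed other[of x] pp by (cases "x = a"; cases "x = b") auto
    qed
    ultimately show "transpose a b \<circ> p \<in> {p \<in> involutions_on S. p a = b}"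
      using fixed by (simp add: involutions_on_def)
  qed
  show "(\<lambda>p. transpose a b \<circ> p) ` {p \<in> involutions_on S. p a = b} \<subseteq> involutions_on (S - {a, b})"
  proof (rule image_subsetI)
    fix p assume "p \<in> {p \<in> involutions_on S. p a = b}"
    then have pa: "p a = b" and perm: "p permutes S" and pp: "\<And>x. p (p x) = x"
      by (auto simp: involutions_on_def fun_eq_iff)
    have pb: "p b = a"
      using pp[of a] pa by simp
    have other: "p x \<noteq> a \<and> p x \<noteq> b" if "x \<noteq> a" "x \<noteq> b" for x
      using that pa pb pp by metis
    have "(transpose a b \<circ> p) permutes S"
      using perm assms by (intro permutes_compose permutes_swap_id)
    \<comment> \<open>The composite fixes \<open>a\<close> and \<open>b\<close>, so its support
      shrinks to the remaining points.\<close>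
    then have "(transpose a b \<circ> p) permutes (S - {a, b})"
      by (rule permutes_superset) (use pa pb in auto)
    moreover have "(transpose a b \<circ> p) \<circ> (transpose a b \<circ> p) = id"
    proof
      fix x
      show "((transpose a b \<circ> p) \<circ> (transpose a b \<circ> p)) x = id x"
        using pa pb other[of x] pp by (cases "x = a"; cases "x = b") auto
    qed
    ultimately show "transpose a b \<circ> p \<in> involutions_on (S - {a, b})"
      by (simp add: involutions_on_def)
  qed
qed

text \<open>The involutions are partitioned by the image \<open>b\<close> of \<open>a\<close>; the
  class \<open>b = a\<close> is the fixed-point case.\<close>

lemma card_involutions_on_split:
  assumes "finite S" "a \<in> S"
  shows "card (involutions_on S) =
    card (involutions_on (S - {a})) + (\<Sum>b\<in>S - {a}. card (involutions_on (S - {a, b})))"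
proof -
  let ?A = "\<lambda>b. {p \<in> involutions_on S. p a = b}"
  have "involutions_on S = (\<Union>b\<in>S. ?A b)"
    using assms(2) by (auto simp: involutions_on_def permutes_in_image)
  then have "card (involutions_on S) = card (\<Union>b\<in>S. ?A b)"
    by simp
  also have "\<dots> = (\<Sum>b\<in>S. card (?A b))"
    using assms(1) by (intro card_UN_disjoint) (auto simp: finite_involutions_on)
  also have "\<dots> = card (?A a) + (\<Sum>b\<in>S - {a}. card (?A b))"
    using assms by (rule sum.remove)
  also have "card (?A a) = card (involutions_on (S - {a}))"
    using involutions_on_fixing[OF assms(2)] by simp
  also have "(\<Sum>b\<in>S - {a}. card (?A b)) = (\<Sum>b\<in>S - {a}. card (involutions_on (S - {a, b})))"
    using assms(2) by (intro sum.cong refl bij_betw_same_card[OF involutions_on_swapping, symmetric]) auto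
  finally show ?thesis .
qed

text \<open>The product is the double factorial \<open>(2k-1)!!\<close>, the number of perfect matchings of \<open>2k\<close> points.\<close>

definition matching_sum :: "nat \<Rightarrow> nat" where
  "matching_sum n = (\<Sum>k\<le>n. (n choose (2 * k)) * (\<Prod>i<k. 2 * i + 1))"

text \<open>Terms with 2k > n vanish, so sums for different arguments can be given a common
  range.\<close>

lemma matching_sum_upto:
  assumes "n \<le> N"
  shows "matching_sum n = (\<Sum>k\<le>N. (n choose (2 * k)) * (\<Prod>i<k. 2 * i + 1))"
  unfolding matching_sum_def using assms by (intro sum.mono_neutral_left) auto

text \<open>Pascal's rule splits each term with positive index. In one half, the new odd factor 2k+1
  is absorbed by (n+1 choose 2k+1) (2k+1) = (n+1) (n choose 2k).\<close>

lemma matching_sum_Suc_Suc: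
  "matching_sum (Suc (Suc n)) = matching_sum (Suc n) + Suc n * matching_sum n"
proof -
  let ?a = "\<lambda>k::nat. \<Prod>i<k. 2 * i + 1"
  have term_eq: "(Suc (Suc n) choose (2 * Suc k)) * ?a (Suc k) =
    (Suc n choose (2 * Suc k)) * ?a (Suc k) + Suc n * ((n choose (2 * k)) * ?a k)" for k
  proof -
    have "(Suc n choose Suc (2 * k)) * (2 * k + 1) = Suc n * (n choose (2 * k))"
      using Suc_times_binomial[of "2 * k" n] by (simp only: Suc_eq_plus1 mult.commute)
    then have "(Suc n choose Suc (2 * k)) * ?a (Suc k) = Suc n * ((n choose (2 * k)) * ?a k)"
      by (simp only: prod.lessThan_Suc) (metis mult.assoc mult.commute)
    moreover have "Suc (Suc n) choose (2 * Suc k) =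
        (Suc n choose Suc (2 * k)) + (Suc n choose (2 * Suc k))"
      by simp
    ultimately show ?thesis
      by (simp only: add_mult_distrib)
  qed
  have "matching_sum (Suc (Suc n)) =
      1 + (\<Sum>k\<le>Suc n. (Suc (Suc n) choose (2 * Suc k)) * ?a (Suc k))"
    unfolding matching_sum_def by (subst sum.atMost_Suc_shift) simp
  also have "\<dots> = (1 + (\<Sum>k\<le>Suc n. (Suc n choose (2 * Suc k)) * ?a (Suc k)))
      + Suc n * (\<Sum>k\<le>Suc n. (n choose (2 * k)) * ?a k)"
    by (simp only: term_eq sum.distrib sum_distrib_left add.assoc)
  also have "1 + (\<Sum>k\<le>Suc n. (Suc n choose (2 * Suc k)) * ?a (Suc k)) = matching_sum (Suc n)"
    by (subst matching_sum_upto[of "Suc n" "Suc (Suc n)"], simp, subst sum.atMost_Suc_shift) simp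
  also have "(\<Sum>k\<le>Suc n. (n choose (2 * k)) * ?a k) = matching_sum n"
    by (rule matching_sum_upto[symmetric]) simp
  finally show ?thesis .
qed

text \<open>Removing a point shows that the count obeys the recurrence of
  \<open>matching_sum\<close>.\<close>

lemma card_involutions_on:
  "finite S \<Longrightarrow> card (involutions_on S) = matching_sum (card S)"
proof (induction "card S" arbitrary: S rule: less_induct)
  case less
  show ?case
  proof (cases "S = {}")
    case True
    have "involutions_on {} = {id :: 'a \<Rightarrow> 'a}"
      by (auto simp: involutions_on_def)
    with True show ?thesis
      by (simp add: matching_sum_def)
  next
    case False
    then obtain a where a: "a \<in> S"
      by blast
    have card_remove: "card (S - {a}) = card S - 1"
      using a less.prems by simp
    have pos: "0 < card S"
      using a less.prems by (auto simp: card_gt_0_iff)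
    have fixing: "card (involutions_on (S - {a})) = matching_sum (card S - 1)"
      using less.hyps[of "S - {a}"] less.prems card_remove pos by simp
    have swapping: "card (involutions_on (S - {a, b})) = matching_sum (card S - 2)"
      if "b \<in> S - {a}" for b
    proof -
      have "card (S - {a, b}) = card S - 2"
        using that a less.prems by (subst card_Diff_subset) auto
      then show ?thesis
        using less.hyps[of "S - {a, b}"] less.prems pos by simp
    qed
    have split: "card (involutions_on S) =
        matching_sum (card S - 1) + (card S - 1) * matching_sum (card S - 2)"
      using card_involutions_on_split[OF less.prems a] fixing swapping card_remove by simp
    show ?thesis
    \<comment> \<open>For a singleton, \<open>card S - 2\<close> truncates to 0, but the factor
      \<open>card S - 1\<close> removes that term.\<close>
    proof (cases "card S = 1")
      case True
      then show ?thesis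
        using split by (simp add: matching_sum_def)
    next
      case False
      then obtain n where "card S = Suc (Suc n)"
        using pos by (cases "card S" rule: nat.exhaust; cases "card S - 1") auto
      then show ?thesis
        using split matching_sum_Suc_Suc[of n] by simp
    qed
  qed
qed

lemma num_involutions_eq_matching_sum: "num_involutions n = matching_sum n"
  using card_involutions_on[of "{1..n}"] by (simp add: num_involutions_def involutions_on_def)

lemma num_involutions_Suc_0: "num_involutions (Suc 0) = 1"
  by (simp add: num_involutions_eq_matching_sum matching_sum_def)

lemma num_involutions_Suc_Suc:
  "num_involutions (Suc (Suc n)) = num_involutions (Suc n) + Suc n * num_involutions n"
  by (simp only: num_involutions_eq_matching_sum matching_sum_Suc_Suc)

text \<open>The even factors of (2k)! multiply to 2^k k!, the odd ones to the double
  factorial.\<close>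

lemma fact_mult_odd_prod: "fact k * 2 ^ k * (\<Prod>i<k. 2 * i + 1) = (fact (2 * k) :: nat)"
proof (induction k)
  case (Suc k)
  have "fact (Suc k) * 2 ^ Suc k * (\<Prod>i<Suc k. 2 * i + 1) =
      (2 * Suc k) * (2 * k + 1) * (fact k * 2 ^ k * (\<Prod>i<k. 2 * i + 1) :: nat)"
    by (simp add: algebra_simps)
  also have "\<dots> = fact (2 * Suc k)"
    by (simp only: Suc.IH) (simp add: algebra_simps)
  finally show ?case .
qed simp

lemma odd_dvd_binomial_mult_odd_prod:
  assumes "odd (m :: nat)" "0 < k"
  shows "m dvd (m choose (2 * k)) * (\<Prod>i<k. 2 * i + 1)"
proof -
  let ?a = "\<Prod>i<k. 2 * i + (1::nat)"
  \<comment> \<open>Since k > 0 gives k \<le> 2k-1, the quotient \<open>q\<close> = (2k-1)!/k! is an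
    integer.\<close>
  have "fact k dvd (fact (2 * k - 1) :: nat)"
    using assms(2) by (intro fact_dvd) simp
  then obtain q where q: "fact (2 * k - 1) = fact k * (q :: nat)" ..
  have "fact k * (2 ^ k * ?a) = fact (2 * k)"
    using fact_mult_odd_prod[of k] by (simp only: mult.assoc)
  also have "\<dots> = 2 * k * fact (2 * k - 1)"
    using assms(2) by (subst fact_reduce) auto
  finally have "fact k * (2 ^ k * ?a) = fact k * (2 * k * q)"
    using q by simp
  then have a: "2 ^ k * ?a = 2 * k * q"
    by simp
  have "2 ^ k * ((m choose (2 * k)) * ?a) = (m choose (2 * k)) * (2 ^ k * ?a)"
    by (rule mult.left_commute)
  also have "\<dots> = (2 * k * (m choose (2 * k))) * q"
    unfolding a by (simp only: ac_simps)
  \<comment> \<open>The factor 2k left over from (2k)! is what absorption needs to bring out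
    \<open>m\<close>.\<close>
  also have "2 * k * (m choose (2 * k)) = m * (m - 1 choose (2 * k - 1))"
    using assms(2) by (intro times_binomial_minus1_eq) simp
  finally have "m dvd 2 ^ k * ((m choose (2 * k)) * ?a)"
    by simp
  moreover have "coprime m (2 ^ k)"
    using assms(1) by simp
  ultimately show ?thesis
    using coprime_dvd_mult_right_iff by blast
qed

lemma num_involutions_odd_cong_1:
  assumes "odd m"
  shows "[num_involutions m = 1] (mod m)"
proof -
  \<comment> \<open>The 1 is the term k = 0, which counts the identity.\<close>
  have "num_involutions m = 1 + (\<Sum>k\<in>{..m} - {0}. (m choose (2 * k)) * (\<Prod>i<k. 2 * i + 1))"
    by (simp add: num_involutions_eq_matching_sum matching_sum_def sum.remove[of "{..m}" 0])
  moreover have "m dvd (\<Sum>k\<in>{..m} - {0}. (m choose (2 * k)) * (\<Prod>i<k. 2 * i + 1))"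
    by (intro dvd_sum odd_dvd_binomial_mult_odd_prod assms) simp
  ultimately show ?thesis
    by (simp only: cong_add_lcancel_0_nat cong_0_iff)
qed

text \<open>Modulo \<open>m\<close> the coefficients of the recurrence also have period
  \<open>m\<close>, so agreement at two consecutive indices suffices.\<close>

lemma num_involutions_add_odd_cong:
  assumes "odd m"
  shows "[num_involutions (n + m) = num_involutions n] (mod m)"
proof (induction n rule: induct_nat_012)
  case 0
  show ?case
    using num_involutions_odd_cong_1[OF assms] by (simp add: num_involutions_0)
next
  case 1
  obtain k where k: "m = Suc k"
    using assms by (cases m) auto
  \<comment> \<open>The other term of the recurrence for t (m+1) is m * t (m-1), which vanishes
    modulo \<open>m\<close>.\<close>
  have "[num_involutions (Suc m) = num_involutions m] (mod m)"
    unfolding k num_involutions_Suc_Suc by (simp only: cong_def mod_mult_self2)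
  then show ?case
    using cong_trans num_involutions_odd_cong_1[OF assms] by (auto simp: num_involutions_Suc_0)
next
  case (ge2 n)
  have "[Suc (n + m) = Suc n] (mod m)"
    by (simp add: cong_def flip: add_Suc)
  from cong_add[OF ge2(2)[simplified] cong_mult[OF this ge2(1)]] show ?case
    by (simp only: add_Suc num_involutions_Suc_Suc)
qed

lemma dvd_num_involutions_period:
  assumes period: "\<forall>n. [num_involutions (n + d) = num_involutions n] (mod m)"
  shows "m dvd d"
proof -
  have t0: "[num_involutions d = 1] (mod m)"
    using period[rule_format, of 0] by (simp add: num_involutions_0)
  have t1: "[num_involutions (Suc d) = 1] (mod m)"
    using period[rule_format, of 1] by (simp add: num_involutions_Suc_0)
  have "[num_involutions (Suc (Suc d)) = 1 + Suc d * 1] (mod m)"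
    unfolding num_involutions_Suc_Suc using t0 t1 by (intro cong_add cong_mult cong_refl)
  moreover have "[num_involutions (Suc (Suc d)) = 2] (mod m)"
    using period[rule_format, of 2]
    by (simp add: numeral_2_eq_2 num_involutions_Suc_Suc num_involutions_Suc_0 num_involutions_0)
  ultimately have "[2 + d = 2 + 0] (mod m)"
    by (simp add: cong_def)
  then show ?thesis
    unfolding cong_add_lcancel_nat cong_0_iff .
qed

theorem theorem6p2:
  fixes m :: nat
  assumes "odd m"
  shows "(\<forall>n. [num_involutions (n + m) = num_involutions n] (mod m)) \<and>
    (\<forall>d. 0 < d \<and> d < m \<longrightarrow>
      \<not> (\<forall>n. [num_involutions (n + d) = num_involutions n] (mod m)))"
  using num_involutions_add_odd_cong[OF assms] dvd_num_involutions_period nat_dvd_not_less by blast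

end
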